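(* The group $$G=\left\langle R_1,R_2\ \middle|\ R_1R_2R_1=R_2R_1R_2,\ R_1^{2}=R_2R_1^{2}R_2\right\rangle$$ is isomorphic to the binary octahedral group $2O$.
   Context: The binary octahedral group $2O$ is the group, under quaternion multiplication, of the following 48 unit quaternions: the 24 Hurwitz units $\pm1,\pm i,\pm j,\pm k,\tfrac12(\pm1\pm i\pm j\pm k)$, together with the 24 elements $\tfrac{1}{\sqrt2}(\pm1\pm i)$, $\tfrac{1}{\sqrt2}(\pm1\pm j)$, $\tfrac{1}{\sqrt2}(\pm1\pm k)$, $\tfrac{1}{\sqrt2}(\pm i\pm j)$, $\tfrac{1}{\sqrt2}(\pm i\pm k)$, $\tfrac{1}{\sqrt2}(\pm j\pm k)$ (all sign choices independent). (In the paper $G$ arises as the group of homotopy classes of paths in $SO(3)$ from the identity to rotational symmetries of the octahedron, and is given by this presentation.) *)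

theory Defs
  imports Complex_Main "HOL-Algebra.Coset"
begin

text \<open>A letter \<open>(True, x)\<close> stands for the generator \<open>x\<close>, and \<open>(False, x)\<close> for its formal
  inverse.\<close>

type_synonym 'a word = "(bool \<times> 'a) list"

definition words :: "'a set \<Rightarrow> 'a word set" where
  "words S = lists (UNIV \<times> S)"

inductive free_eq :: "'a word \<Rightarrow> 'a word \<Rightarrow> bool" where
  cancel: "free_eq (u @ (b, x) # (\<not> b, x) # v) (u @ v)"
| refl: "free_eq u u"
| sym: "free_eq u v \<Longrightarrow> free_eq v u"
| trans: "free_eq u v \<Longrightarrow> free_eq v w \<Longrightarrow> free_eq u w"

definition free_rel :: "'a set \<Rightarrow> ('a word \<times> 'a word) set" where
  "free_rel S = {(u, v). u \<in> words S \<and> v \<in> words S \<and> free_eq u v}"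

definition free_group :: "'a set \<Rightarrow> 'a word set monoid" where
  "free_group S =
    \<lparr>carrier = words S // free_rel S,
     mult = (\<lambda>A B. \<Union>a\<in>A. \<Union>b\<in>B. free_rel S `` {a @ b}),
     one = free_rel S `` {[]}\<rparr>"

definition free_gen :: "'a set \<Rightarrow> 'a \<Rightarrow> 'a word set" where
  "free_gen S x = free_rel S `` {[(True, x)]}"

definition normal_closure :: "('a, 'b) monoid_scheme \<Rightarrow> 'a set \<Rightarrow> 'a set" where
  "normal_closure G A = \<Inter> {N. N \<lhd> G \<and> A \<subseteq> N}"

text \<open>A pair \<open>(u, v)\<close> of elements of the free group is read as the defining relation \<open>u = v\<close>.\<close>

definition presented_group ::
    "'a set \<Rightarrow> ('a word set \<times> 'a word set) set \<Rightarrow> 'a word set set monoid" where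
  "presented_group S R =
    free_group S Mod
      normal_closure (free_group S)
        {u \<otimes>\<^bsub>free_group S\<^esub> inv\<^bsub>free_group S\<^esub> v | u v. (u, v) \<in> R}"

lemma free_eq_append_left: "free_eq u v \<Longrightarrow> free_eq (w @ u) (w @ v)"
proof (induction rule: free_eq.induct)
  case (cancel u b x v)
  show ?case using free_eq.cancel[of "w @ u" b x v] by simp
qed (auto intro: free_eq.intros)

lemma free_eq_append_right: "free_eq u v \<Longrightarrow> free_eq (u @ w) (v @ w)"
proof (induction rule: free_eq.induct)
  case (cancel u b x v)
  show ?case using free_eq.cancel[of u b x "v @ w"] by simp
qed (auto intro: free_eq.intros)

lemma free_eq_append: "free_eq u u' \<Longrightarrow> free_eq v v' \<Longrightarrow> free_eq (u @ v) (u' @ v')"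
  by (meson free_eq_append_left free_eq_append_right free_eq.trans)

lemma words_append [simp]: "u @ v \<in> words S \<longleftrightarrow> u \<in> words S \<and> v \<in> words S"
  by (auto simp: words_def)

lemma words_Nil [simp]: "[] \<in> words S"
  by (simp add: words_def)

lemma words_Cons [simp]: "(b, x) # u \<in> words S \<longleftrightarrow> x \<in> S \<and> u \<in> words S"
  by (auto simp: words_def)

lemma equiv_free_rel: "equiv (words S) (free_rel S)"
  by (intro equivI refl_onI symI transI)
    (auto simp: free_rel_def intro: free_eq.refl free_eq.sym free_eq.trans)

lemma free_group_mult_class:
  assumes "u \<in> words S" "v \<in> words S"
  shows "free_rel S `` {u} \<otimes>\<^bsub>free_group S\<^esub> free_rel S `` {v} = free_rel S `` {u @ v}"
proof -
  have "(\<lambda>a b. free_rel S `` {a @ b}) respects2 free_rel S"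
    by (rule congruent2I'[OF equiv_class_eq[OF equiv_free_rel]])
      (auto simp: free_rel_def intro: free_eq_append)
  then show ?thesis
    using UN_equiv_class2[OF equiv_free_rel equiv_free_rel _ assms] by (simp add: free_group_def)
qed

lemma free_group_carrier: "carrier (free_group S) = (\<lambda>u. free_rel S `` {u}) ` words S"
  by (auto simp: free_group_def quotient_def)

lemma free_gen_closed: "x \<in> S \<Longrightarrow> free_gen S x \<in> carrier (free_group S)"
  by (simp add: free_gen_def free_group_carrier)

lemma free_group_one: "\<one>\<^bsub>free_group S\<^esub> = free_rel S `` {[]}"
  by (simp add: free_group_def)

definition word_inv :: "'a word \<Rightarrow> 'a word" where
  "word_inv u = rev (map (\<lambda>(b, x). (\<not> b, x)) u)"

lemma word_inv_words: "u \<in> words S \<Longrightarrow> word_inv u \<in> words S"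
  by (auto simp: words_def word_inv_def)

lemma free_eq_word_inv: "free_eq (word_inv u @ u) []"
proof (induction u)
  case Nil
  show ?case by (simp add: word_inv_def free_eq.refl)
next
  case (Cons p u)
  obtain b x where p: "p = (b, x)" by fastforce
  have "free_eq (word_inv u @ (\<not> b, x) # (\<not> \<not> b, x) # u) (word_inv u @ u)"
    by (rule free_eq.cancel)
  then have "free_eq (word_inv (p # u) @ p # u) (word_inv u @ u)"
    by (simp add: p word_inv_def)
  then show ?case using Cons.IH by (rule free_eq.trans)
qed

lemma group_free_group: "group (free_group S)"
proof (rule groupI)
  fix A assume "A \<in> carrier (free_group S)"
  then obtain u where u: "u \<in> words S" "A = free_rel S `` {u}"
    by (auto simp: free_group_carrier)
  have "free_rel S `` {word_inv u @ u} = free_rel S `` {[]}"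
    using u by (intro equiv_class_eq[OF equiv_free_rel])
      (simp add: free_rel_def free_eq_word_inv word_inv_words)
  then show "\<exists>B\<in>carrier (free_group S). B \<otimes>\<^bsub>free_group S\<^esub> A = \<one>\<^bsub>free_group S\<^esub>"
    using u by (intro bexI[of _ "free_rel S `` {word_inv u}"])
      (auto simp: free_group_carrier free_group_mult_class free_group_one word_inv_words)
qed (auto simp: free_group_carrier free_group_mult_class free_group_one)

lemma (in group) normal_closure_normal:
  assumes "A \<subseteq> carrier G"
  shows "normal_closure G A \<lhd> G"
proof -
  have ne: "{N. N \<lhd> G \<and> A \<subseteq> N} \<noteq> {}"
  proof -
    have "carrier G \<lhd> G"
      using subgroup_self by (auto simp: normal_inv_iff)
    then show ?thesis using assms by blast
  qed
  have sub: "subgroup (normal_closure G A) G"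
    unfolding normal_closure_def
    using ne by (intro subgroups_Inter) (auto simp: normal_imp_subgroup)
  have "x \<otimes> h \<otimes> inv x \<in> normal_closure G A"
    if "x \<in> carrier G" "h \<in> normal_closure G A" for x h
    using that by (auto simp: normal_closure_def normal_inv_iff)
  with sub show ?thesis by (auto simp: normal_inv_iff)
qed

lemma group_presented_group:
  assumes "R \<subseteq> carrier (free_group S) \<times> carrier (free_group S)"
  shows "group (presented_group S R)"
proof -
  interpret F: group "free_group S" by (rule group_free_group)
  show ?thesis
    unfolding presented_group_def
    using assms by (intro normal.factorgroup_is_group F.normal_closure_normal) auto
qed

datatype generator = R1 | R2

definition octahedral_presentation :: "generator word set set monoid" where
  "octahedral_presentation =
    (let F = free_group {R1, R2};
         r1 = free_gen {R1, R2} R1;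
         r2 = free_gen {R1, R2} R2
     in
    presented_group {R1, R2}
      {(r1 \<otimes>\<^bsub>F\<^esub> r2 \<otimes>\<^bsub>F\<^esub> r1, r2 \<otimes>\<^bsub>F\<^esub> r1 \<otimes>\<^bsub>F\<^esub> r2),
       (r1 [^]\<^bsub>F\<^esub> (2::nat), r2 \<otimes>\<^bsub>F\<^esub> r1 [^]\<^bsub>F\<^esub> (2::nat) \<otimes>\<^bsub>F\<^esub> r2)})"

lemma group_octahedral_presentation: "group octahedral_presentation"
proof -
  interpret F: group "free_group {R1, R2}" by (rule group_free_group)
  show ?thesis
    unfolding octahedral_presentation_def Let_def
    by (rule group_presented_group) (auto intro!: F.m_closed F.nat_pow_closed free_gen_closed)
qed

text \<open>\<open>Quat a b c d\<close> is the quaternion $a + bi + cj + dk$.\<close>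

datatype quat = Quat real real real real

fun quat_mult :: "quat \<Rightarrow> quat \<Rightarrow> quat" where
  "quat_mult (Quat a b c d) (Quat a' b' c' d') =
    Quat (a * a' - b * b' - c * c' - d * d')
         (a * b' + b * a' + c * d' - d * c')
         (a * c' - b * d' + c * a' + d * b')
         (a * d' + b * c' - c * b' + d * a')"

definition signs :: "real set" where
  "signs = {1, -1}"

definition hurwitz_units :: "quat set" where
  "hurwitz_units =
    {Quat s 0 0 0 | s. s \<in> signs} \<union> {Quat 0 s 0 0 | s. s \<in> signs} \<union>
    {Quat 0 0 s 0 | s. s \<in> signs} \<union> {Quat 0 0 0 s | s. s \<in> signs} \<union>
    {Quat (s / 2) (t / 2) (u / 2) (v / 2) | s t u v.
      s \<in> signs \<and> t \<in> signs \<and> u \<in> signs \<and> v \<in> signs}"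

definition octahedral_extra_units :: "quat set" where
  "octahedral_extra_units =
    {Quat (s / sqrt 2) (t / sqrt 2) 0 0 | s t. s \<in> signs \<and> t \<in> signs} \<union>
    {Quat (s / sqrt 2) 0 (t / sqrt 2) 0 | s t. s \<in> signs \<and> t \<in> signs} \<union>
    {Quat (s / sqrt 2) 0 0 (t / sqrt 2) | s t. s \<in> signs \<and> t \<in> signs} \<union>
    {Quat 0 (s / sqrt 2) (t / sqrt 2) 0 | s t. s \<in> signs \<and> t \<in> signs} \<union>
    {Quat 0 (s / sqrt 2) 0 (t / sqrt 2) | s t. s \<in> signs \<and> t \<in> signs} \<union>
    {Quat 0 0 (s / sqrt 2) (t / sqrt 2) | s t. s \<in> signs \<and> t \<in> signs}"

definition binary_octahedral_group :: "quat monoid" where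
  "binary_octahedral_group =
    \<lparr>carrier = hurwitz_units \<union> octahedral_extra_units,
     mult = quat_mult,
     one = Quat 1 0 0 0\<rparr>"

lemma quat_mult_units:
  shows "quat_mult (Quat 0 1 0 0) (Quat 0 1 0 0) = Quat (-1) 0 0 0"
    and "quat_mult (Quat 0 0 1 0) (Quat 0 0 1 0) = Quat (-1) 0 0 0"
    and "quat_mult (Quat 0 0 0 1) (Quat 0 0 0 1) = Quat (-1) 0 0 0"
    and "quat_mult (Quat 0 1 0 0) (Quat 0 0 1 0) = Quat 0 0 0 1"
    and "quat_mult (Quat 0 0 1 0) (Quat 0 0 0 1) = Quat 0 1 0 0"
    and "quat_mult (Quat 0 0 0 1) (Quat 0 1 0 0) = Quat 0 0 1 0"
  by simp_all

end

theory Submission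
  imports Defs "HOL-Algebra.Generated_Groups"
begin

text \<open>Let \<open>a = (1 + i)/\<surd>2\<close> and \<open>b = (1 + j)/\<surd>2\<close> in the group of unit quaternions. They satisfy the
  two defining relations, so the presented group maps to the unit quaternions, and the image is the
  subgroup generated by \<open>a\<close> and \<open>b\<close>. It remains to see that this subgroup is \<open>2O\<close> and that nothing
  is lost in the kernel. Both follow from a normal form which is derived from the two relations alone,
  in an arbitrary group (the locale \<open>octahedral_pair\<close>).

  Put \<open>I = a\<^sup>2\<close> and \<open>J = b\<^sup>2\<close>. The braid relation makes \<open>a b a\<close> exchange \<open>a\<close> and \<open>b\<close> under
  conjugation, so everything proved for \<open>(a, b)\<close> also holds for \<open>(b, a)\<close>. The second relation gives
  \<open>J I J = b (b I b) b = I\<close>, hence \<open>I J I = J\<close> by symmetry. Both relations together give \<open>I\<^sup>2 = J\<^sup>2\<close>. From these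
  three equations \<open>I\<^sup>4 = 1\<close> follows, so \<open>I\<close> and \<open>J\<close> generate a quotient of the quaternion group of
  order 8. It is normalised by \<open>a\<close> and \<open>b\<close>, and modulo it the relations become \<open>a\<^sup>2 = b\<^sup>2 = 1\<close> and
  \<open>a b a = b a b\<close>, which present the symmetric group on three letters. Hence every element generated
  by \<open>a\<close> and \<open>b\<close> is one of the 48 products of an element \<open>I\<^sup>m J\<^sup>n\<close> with \<open>m < 4\<close>, \<open>n < 2\<close> and an element of
  \<open>{1, a, b, ab, ba, aba}\<close> (lemma \<open>generate_eq_normal_forms\<close>).

  For the unit quaternions these products are exactly the 48 elements of \<open>2O\<close>, and only the trivial
  product equals 1. The first fact identifies the image of the presented group. The second shows that
  the homomorphism is injective: an element of the kernel has a normal form, whose image is the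
  corresponding normal form of 1.\<close>

section \<open>Homomorphisms out of presented groups\<close>

lemma free_group_inv_gen:
  assumes "x \<in> S"
  shows "free_rel S `` {[(False, x)]} = inv\<^bsub>free_group S\<^esub> free_gen S x"
proof -
  interpret F: group "free_group S" by (rule group_free_group)
  have "free_eq [(False, x), (True, x)] []"
    using free_eq.cancel[of "[]" False x "[]"] by simp
  then have "free_rel S `` {[(False, x), (True, x)]} = free_rel S `` {[]}"
    using assms by (intro equiv_class_eq[OF equiv_free_rel]) (simp add: free_rel_def)
  then have "free_rel S `` {[(False, x)]} \<otimes>\<^bsub>free_group S\<^esub> free_gen S x = \<one>\<^bsub>free_group S\<^esub>"
    using assms by (simp add: free_gen_def free_group_mult_class free_group_one)
  then show ?thesis
    using assms F.inv_equality[of "free_rel S `` {[(False, x)]}" "free_gen S x"]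
    by (simp add: free_gen_closed) (simp add: free_group_carrier)
qed

lemma free_group_generated:
  "carrier (free_group S) = generate (free_group S) (free_gen S ` S)"
proof
  interpret F: group "free_group S" by (rule group_free_group)
  show "generate (free_group S) (free_gen S ` S) \<subseteq> carrier (free_group S)"
    by (rule F.generate_incl) (auto intro: free_gen_closed)
  have "free_rel S `` {u} \<in> generate (free_group S) (free_gen S ` S)" if "u \<in> words S" for u
    using that
  proof (induction u)
    case Nil
    show ?case using generate.one[of "free_group S"] by (simp add: free_group_one)
  next
    case (Cons p u)
    obtain s x where p: "p = (s, x)" by fastforce
    with Cons.prems have x: "x \<in> S" and u: "u \<in> words S" by auto
    have "free_rel S `` {[(s, x)]} \<in> generate (free_group S) (free_gen S ` S)"
    proof (cases s)
      case True
      have "free_gen S x \<in> generate (free_group S) (free_gen S ` S)"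
        using x by (intro generate.incl imageI)
      then show ?thesis using True by (simp add: free_gen_def)
    next
      case False
      then show ?thesis
        using x generate.inv[of "free_gen S x" "free_gen S ` S"] by (simp add: free_group_inv_gen)
    qed
    then have "free_rel S `` {[(s, x)]} \<otimes>\<^bsub>free_group S\<^esub> free_rel S `` {u}
        \<in> generate (free_group S) (free_gen S ` S)"
      using Cons.IH[OF u] by (rule generate.eng)
    then show ?case using x u by (simp add: free_group_mult_class p)
  qed
  then show "carrier (free_group S) \<subseteq> generate (free_group S) (free_gen S ` S)"
    by (auto simp: free_group_carrier)
qed

text \<open>The value of a word under the assignment \<open>\<phi>\<close> of group elements to letters; this is the
  homomorphism that \<open>\<phi>\<close> induces on the free group, before passing to classes of words.\<close>
fun word_value :: "('b, 'c) monoid_scheme \<Rightarrow> ('a \<Rightarrow> 'b) \<Rightarrow> 'a word \<Rightarrow> 'b" where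
  "word_value H \<phi> [] = \<one>\<^bsub>H\<^esub>"
| "word_value H \<phi> ((s, x) # u) =
    (if s then \<phi> x else inv\<^bsub>H\<^esub> \<phi> x) \<otimes>\<^bsub>H\<^esub> word_value H \<phi> u"

context group
begin

lemma word_value_closed:
  assumes "\<phi> \<in> S \<rightarrow> carrier G" "u \<in> words S"
  shows "word_value G \<phi> u \<in> carrier G"
  using assms(2)
proof (induction u)
  case (Cons p u)
  then show ?case using assms(1) by (cases p) (auto simp: Pi_iff)
qed simp

lemma word_value_append:
  assumes "\<phi> \<in> S \<rightarrow> carrier G" "u \<in> words S" "v \<in> words S"
  shows "word_value G \<phi> (u @ v) = word_value G \<phi> u \<otimes> word_value G \<phi> v"
  using assms(2)
proof (induction u)
  case Nil
  then show ?case using word_value_closed[OF assms(1,3)] by simp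
next
  case (Cons p u)
  then show ?case
    using assms(1) word_value_closed[OF assms(1)] assms(3)
    by (cases p) (auto simp: Pi_iff m_assoc)
qed

text \<open>The intermediate words of a chain of cancellations may contain arbitrary letters, so every
  letter needs a value in the group.\<close>

lemma word_value_free_eq:
  assumes "free_eq u v" "\<And>x. \<phi> x \<in> carrier G"
  shows "word_value G \<phi> u = word_value G \<phi> v"
  using assms(1)
proof (induction rule: free_eq.induct)
  case (cancel u s x v)
  have \<phi>: "\<phi> \<in> UNIV \<rightarrow> carrier G" using assms(2) by blast
  have W: "w \<in> words UNIV" for w :: "'c word" by (auto simp: words_def)
  have v: "word_value G \<phi> v \<in> carrier G" by (rule word_value_closed[OF \<phi> W])
  have "word_value G \<phi> ((s, x) # (\<not> s, x) # v) = word_value G \<phi> v"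
    using v assms(2) by (simp flip: m_assoc)
  then show ?case using word_value_append[OF \<phi> W W] by metis
qed auto

text \<open>The universal property of the free group. The assignment is extended by \<open>1\<close> to letters outside
  \<open>S\<close>, so that it is invariant under every chain of cancellations.\<close>

lemma free_group_universal:
  assumes \<phi>: "\<phi> \<in> S \<rightarrow> carrier G"
  obtains h where "h \<in> hom (free_group S) G" "\<And>x. x \<in> S \<Longrightarrow> h (free_gen S x) = \<phi> x"
proof -
  define \<psi> where "\<psi> x = (if x \<in> S then \<phi> x else \<one>)" for x
  have \<psi>: "\<psi> x \<in> carrier G" for x using \<phi> by (auto simp: \<psi>_def)
  then have \<psi>': "\<psi> \<in> S \<rightarrow> carrier G" by blast
  define h where "h A = the_elem (word_value G \<psi> ` A)" for A
  have h: "h (free_rel S `` {u}) = word_value G \<psi> u" if u: "u \<in> words S" for u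
  proof -
    have "word_value G \<psi> ` (free_rel S `` {u}) = {word_value G \<psi> u}"
      using u word_value_free_eq[of u _ \<psi>] \<psi>
      by (auto simp: free_rel_def intro: free_eq.refl)
    then show ?thesis by (simp add: h_def)
  qed
  have "h \<in> hom (free_group S) G"
    by (rule homI)
      (auto simp: free_group_carrier free_group_mult_class h word_value_append[OF \<psi>']
        intro: word_value_closed[OF \<psi>'])
  moreover have "h (free_gen S x) = \<phi> x" if "x \<in> S" for x
    using that \<psi>[of x] by (simp add: free_gen_def h) (simp add: \<psi>_def)
  ultimately show ?thesis by (rule that)
qed

lemma nat_pow_2: "x \<in> carrier G \<Longrightarrow> x [^] (2::nat) = x \<otimes> x"
  by (simp add: numeral_2_eq_2)

end

text \<open>The canonical projection of the free group onto the presented group.\<close>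
definition presented_class ::
    "'a set \<Rightarrow> ('a word set \<times> 'a word set) set \<Rightarrow> 'a word set \<Rightarrow> 'a word set set" where
  "presented_class S R u =
    normal_closure (free_group S)
      {u \<otimes>\<^bsub>free_group S\<^esub> inv\<^bsub>free_group S\<^esub> v | u v. (u, v) \<in> R} #>\<^bsub>free_group S\<^esub> u"

context
  fixes S :: "'a set" and R :: "('a word set \<times> 'a word set) set"
  assumes R: "R \<subseteq> carrier (free_group S) \<times> carrier (free_group S)"
begin

interpretation F: group "free_group S" by (rule group_free_group)

abbreviation "relators \<equiv> {u \<otimes>\<^bsub>free_group S\<^esub> inv\<^bsub>free_group S\<^esub> v | u v. (u, v) \<in> R}"

lemma relators_closed: "relators \<subseteq> carrier (free_group S)"
  using R by auto

lemma presented_class_hom: "presented_class S R \<in> hom (free_group S) (presented_group S R)"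
  unfolding presented_class_def presented_group_def
  by (rule normal.r_coset_hom_Mod[OF F.normal_closure_normal[OF relators_closed]])

lemma presented_class_surj:
  "carrier (presented_group S R) = presented_class S R ` carrier (free_group S)"
  by (simp add: presented_class_def presented_group_def carrier_FactGroup)

lemma presented_class_relation:
  assumes "(u, v) \<in> R"
  shows "presented_class S R u = presented_class S R v"
proof -
  let ?N = "normal_closure (free_group S) relators"
  have N: "?N \<lhd> free_group S" by (rule F.normal_closure_normal[OF relators_closed])
  have "u \<otimes>\<^bsub>free_group S\<^esub> inv\<^bsub>free_group S\<^esub> v \<in> ?N"
    using assms by (auto simp: normal_closure_def)
  moreover have "u \<in> carrier (free_group S)" "v \<in> carrier (free_group S)" using assms R by auto
  ultimately have "u \<in> ?N #>\<^bsub>free_group S\<^esub> v"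
    using subgroup.rcos_module_rev[OF normal_imp_subgroup[OF N] F.is_group] by blast
  then show ?thesis
    unfolding presented_class_def
    using F.repr_independence[OF _ _ normal_imp_subgroup[OF N]] \<open>v \<in> carrier _\<close> by blast
qed

lemma presented_group_generated:
  "carrier (presented_group S R) =
    generate (presented_group S R) (presented_class S R ` free_gen S ` S)"
proof -
  interpret P: group "presented_group S R" by (rule group_presented_group[OF R])
  interpret group_hom "free_group S" "presented_group S R" "presented_class S R"
    by unfold_locales (rule presented_class_hom)
  have "free_gen S ` S \<subseteq> carrier (free_group S)" by (auto intro: free_gen_closed)
  from generate_img[OF this] show ?thesis
    by (simp add: presented_class_surj flip: free_group_generated)
qed

text \<open>The universal property of a presented group: a homomorphism that respects the relations
  kills the relators, hence also the normal subgroup that they generate.\<close>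

lemma presented_group_universal:
  assumes H: "group H" and h: "h \<in> hom (free_group S) H"
    and rel: "\<And>u v. (u, v) \<in> R \<Longrightarrow> h u = h v"
  obtains g where "g \<in> hom (presented_group S R) H"
    "\<And>u. u \<in> carrier (free_group S) \<Longrightarrow> g (presented_class S R u) = h u"
proof -
  interpret H: group H by (rule H)
  interpret h: group_hom "free_group S" H h by unfold_locales (rule h)
  let ?N = "normal_closure (free_group S) relators"
  have N: "?N \<lhd> free_group S" by (rule F.normal_closure_normal[OF relators_closed])
  have "h (u \<otimes>\<^bsub>free_group S\<^esub> inv\<^bsub>free_group S\<^esub> v) = \<one>\<^bsub>H\<^esub>" if "(u, v) \<in> R" for u v
  proof -
    have "u \<in> carrier (free_group S)" "v \<in> carrier (free_group S)" using that R by auto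
    then show ?thesis using rel[OF that] by simp
  qed
  then have "relators \<subseteq> kernel (free_group S) H h"
    using relators_closed unfolding kernel_def by blast
  then have ker: "?N \<subseteq> kernel (free_group S) H h"
    using h.normal_kernel unfolding normal_closure_def by blast
  show ?thesis
    by (rule h.FactGroup_universal_kernel[OF N ker])
      (rule that, simp_all add: presented_class_def presented_group_def)
qed

end

section \<open>Pairs of elements satisfying the octahedral relations\<close>

text \<open>The locale has two instances: the presented group, which \<open>a\<close> and \<open>b\<close> generate, and the infinite
  group of unit quaternions, in which they generate \<open>2O\<close>.\<close>

locale octahedral_pair = group G for G (structure) +
  fixes a b
  assumes a [simp]: "a \<in> carrier G" and b [simp]: "b \<in> carrier G"
    and braid: "a \<otimes> b \<otimes> a = b \<otimes> a \<otimes> b"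
    and square: "a \<otimes> a = b \<otimes> (a \<otimes> a) \<otimes> b"
begin

abbreviation "I \<equiv> a \<otimes> a"
abbreviation "J \<equiv> b \<otimes> b"

text \<open>In the braid group on three strands this is the fact that the half twist \<open>a b a\<close> exchanges the
  two generators.\<close>

lemma garside_conjugation:
  "(a \<otimes> b \<otimes> a) \<otimes> a = b \<otimes> (a \<otimes> b \<otimes> a)" "(a \<otimes> b \<otimes> a) \<otimes> b = a \<otimes> (a \<otimes> b \<otimes> a)"
proof -
  have "(a \<otimes> b \<otimes> a) \<otimes> a = (b \<otimes> a \<otimes> b) \<otimes> a" by (simp add: braid)
  then show "(a \<otimes> b \<otimes> a) \<otimes> a = b \<otimes> (a \<otimes> b \<otimes> a)" by (simp add: m_assoc)
  have "(a \<otimes> b \<otimes> a) \<otimes> b = a \<otimes> (b \<otimes> a \<otimes> b)" by (simp add: m_assoc)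
  then show "(a \<otimes> b \<otimes> a) \<otimes> b = a \<otimes> (a \<otimes> b \<otimes> a)" by (simp add: braid)
qed

text \<open>The second relation is not symmetric in \<open>a\<close> and \<open>b\<close> as written. Conjugating it by \<open>a b a\<close>
  produces its mirror image, which halves the work below.\<close>

lemma swap: "octahedral_pair G b a"
proof
  define d where "d = a \<otimes> b \<otimes> a"
  have dG: "d \<in> carrier G" by (simp add: d_def)
  have da: "d \<otimes> a = b \<otimes> d" and db: "d \<otimes> b = a \<otimes> d"
    using garside_conjugation by (simp_all add: d_def)
  have da': "d \<otimes> (a \<otimes> x) = b \<otimes> (d \<otimes> x)" and db': "d \<otimes> (b \<otimes> x) = a \<otimes> (d \<otimes> x)"
    if "x \<in> carrier G" for x
    using that da db dG by (metis a b m_assoc)+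
  have "J \<otimes> d = d \<otimes> I"
    using dG by (simp add: m_assoc da da')
  also have "\<dots> = d \<otimes> (b \<otimes> (a \<otimes> (a \<otimes> b)))" using square by (simp add: m_assoc)
  also have "\<dots> = (a \<otimes> J \<otimes> a) \<otimes> d"
    using dG by (simp add: m_assoc da da' db db')
  finally show "J = a \<otimes> J \<otimes> a" using dG by simp
qed (simp_all add: braid)

lemma b_I_J: "b \<otimes> I \<otimes> J = I \<otimes> b"
proof -
  have "b \<otimes> I \<otimes> J = (b \<otimes> I \<otimes> b) \<otimes> b" by (simp add: m_assoc)
  then show ?thesis by (simp flip: square)
qed

lemma a_J_I: "a \<otimes> J \<otimes> I = J \<otimes> a"
  by (rule octahedral_pair.b_I_J[OF swap])

lemma J_I_J: "J \<otimes> I \<otimes> J = I"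
proof -
  have "J \<otimes> I \<otimes> J = b \<otimes> (b \<otimes> I \<otimes> b) \<otimes> b" by (simp add: m_assoc)
  then show ?thesis by (simp flip: square)
qed

lemma I_J_I: "I \<otimes> J \<otimes> I = J"
  by (rule octahedral_pair.J_I_J[OF swap])

text \<open>Both sides equal \<open>(a b a)\<^sup>2\<close>. This common value corresponds to the quaternion \<open>-1\<close>.\<close>

lemma I_square_eq_J_square: "I \<otimes> I = J \<otimes> J"
proof -
  have sqJ: "J = a \<otimes> J \<otimes> a" using octahedral_pair.square[OF swap] .
  have "I \<otimes> I = a \<otimes> I \<otimes> a" by (simp add: m_assoc)
  also have "\<dots> = a \<otimes> (b \<otimes> I \<otimes> b) \<otimes> a" by (simp flip: square)
  also have "\<dots> = (a \<otimes> b \<otimes> a) \<otimes> (a \<otimes> b \<otimes> a)" by (simp add: m_assoc)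
  also have "\<dots> = (b \<otimes> a \<otimes> b) \<otimes> (b \<otimes> a \<otimes> b)" by (simp add: braid)
  also have "\<dots> = b \<otimes> (a \<otimes> J \<otimes> a) \<otimes> b" by (simp add: m_assoc)
  also have "\<dots> = b \<otimes> J \<otimes> b" by (simp flip: sqJ)
  also have "\<dots> = J \<otimes> J" by (simp add: m_assoc)
  finally show ?thesis .
qed

lemma IJ_closed: "I \<in> carrier G" "J \<in> carrier G"
  by simp_all

text \<open>Write \<open>c = I\<^sup>2 = J\<^sup>2\<close>. From \<open>J I J = I\<close> and \<open>I J I = J\<close> one gets \<open>I J = J I c\<close> and \<open>J I = I J c\<close>;
  moving \<open>I\<close> past \<open>J\<close> and back costs \<open>c\<^sup>2\<close>, which must therefore be trivial.\<close>

lemma I_pow_4: "I \<otimes> I \<otimes> (I \<otimes> I) = \<one>"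
proof -
  have "I \<otimes> J \<otimes> \<one> = I \<otimes> J" by simp
  also have "\<dots> = (J \<otimes> I \<otimes> J) \<otimes> J" by (simp only: J_I_J)
  also have "\<dots> = J \<otimes> I \<otimes> (J \<otimes> J)" by (simp add: m_assoc)
  also have "\<dots> = (I \<otimes> J \<otimes> I) \<otimes> I \<otimes> (I \<otimes> I)" by (simp only: I_J_I I_square_eq_J_square)
  also have "\<dots> = I \<otimes> J \<otimes> (I \<otimes> I \<otimes> (I \<otimes> I))" by (simp add: m_assoc)
  finally show ?thesis by (metis IJ_closed Units_eq Units_l_cancel m_closed one_closed)
qed

lemma J_I: "J \<otimes> I = I \<otimes> I \<otimes> I \<otimes> J"
proof -
  have "J \<otimes> I = I \<otimes> I \<otimes> (I \<otimes> I) \<otimes> (J \<otimes> I)" by (simp only: I_pow_4) simp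
  also have "\<dots> = I \<otimes> I \<otimes> I \<otimes> (I \<otimes> J \<otimes> I)" by (simp add: m_assoc)
  finally show ?thesis by (simp only: I_J_I)
qed

text \<open>The quaternion identity \<open>a j a\<inverse> = k\<close>; here \<open>I J\<close> plays the role of \<open>k\<close>.\<close>

lemma a_J: "a \<otimes> J = I \<otimes> J \<otimes> a"
proof -
  have "a \<otimes> J = a \<otimes> J \<otimes> (I \<otimes> I \<otimes> (I \<otimes> I))" by (simp only: I_pow_4) simp
  also have "\<dots> = (a \<otimes> J \<otimes> I) \<otimes> (I \<otimes> I \<otimes> I)" by (simp add: m_assoc)
  also have "\<dots> = J \<otimes> a \<otimes> (I \<otimes> I \<otimes> I)" by (simp only: a_J_I)
  also have "\<dots> = J \<otimes> (I \<otimes> I) \<otimes> (I \<otimes> a)" by (simp add: m_assoc)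
  also have "\<dots> = J \<otimes> (J \<otimes> J) \<otimes> (I \<otimes> a)" by (simp only: I_square_eq_J_square)
  also have "\<dots> = (J \<otimes> J) \<otimes> J \<otimes> I \<otimes> a" by (simp add: m_assoc)
  also have "\<dots> = (I \<otimes> I) \<otimes> J \<otimes> I \<otimes> a" by (simp only: I_square_eq_J_square)
  also have "\<dots> = I \<otimes> (I \<otimes> J \<otimes> I) \<otimes> a" by (simp add: m_assoc)
  finally show ?thesis by (simp only: I_J_I)
qed

text \<open>The quaternion identity \<open>b i b\<inverse> = - k\<close>, with \<open>- 1\<close> represented by \<open>I\<^sup>2\<close>.\<close>

lemma b_I: "b \<otimes> I = I \<otimes> I \<otimes> I \<otimes> J \<otimes> b"
proof -
  have "b \<otimes> I = b \<otimes> I \<otimes> (J \<otimes> J \<otimes> (J \<otimes> J))"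
    by (simp only: I_pow_4 flip: I_square_eq_J_square) simp
  also have "\<dots> = (b \<otimes> I \<otimes> J) \<otimes> (J \<otimes> J \<otimes> J)" by (simp add: m_assoc)
  also have "\<dots> = I \<otimes> b \<otimes> (J \<otimes> J \<otimes> J)" by (simp only: b_I_J)
  also have "\<dots> = I \<otimes> (J \<otimes> J) \<otimes> J \<otimes> b" by (simp add: m_assoc)
  also have "\<dots> = I \<otimes> (I \<otimes> I) \<otimes> J \<otimes> b" by (simp only: I_square_eq_J_square)
  finally show ?thesis by (simp add: m_assoc)
qed

text \<open>The image of the quaternion group of order 8. Unbounded exponents make closure under
  multiplication immediate from the commutation rule; the bound on the exponents comes afterwards.\<close>
definition quat_part where "quat_part = {I [^] (m::nat) \<otimes> J [^] (n::nat) | m n. True}"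

lemma quat_part_closed: "q \<in> quat_part \<Longrightarrow> q \<in> carrier G"
  by (auto simp: quat_part_def)

lemma quat_partI: "I [^] (m::nat) \<otimes> J [^] (n::nat) \<in> quat_part"
  by (auto simp: quat_part_def)

lemma quat_part_one: "\<one> \<in> quat_part" and quat_part_I: "I \<in> quat_part" and quat_part_J: "J \<in> quat_part"
  using quat_partI[of 0 0] quat_partI[of 1 0] quat_partI[of 0 1] by simp_all

lemma J_pow_past_I_pow: "\<exists>k. J [^] (n::nat) \<otimes> I [^] (m::nat) = I [^] (k::nat) \<otimes> J [^] n"
proof -
  have 1: "J \<otimes> I [^] (m::nat) = I [^] (3 * m) \<otimes> J" for m
  proof (induction m)
    case (Suc m)
    have "J \<otimes> I [^] Suc m = (J \<otimes> I [^] m) \<otimes> I" by (simp add: m_assoc)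
    also have "\<dots> = I [^] (3 * m) \<otimes> (J \<otimes> I)" by (simp add: Suc.IH) (simp add: m_assoc)
    also have "\<dots> = I [^] (3 * m) \<otimes> (I \<otimes> I \<otimes> I) \<otimes> J" by (simp only: J_I) (simp add: m_assoc)
    also have "I [^] (3 * m) \<otimes> (I \<otimes> I \<otimes> I) = I [^] (3 * Suc m)"
      by (simp add: numeral_3_eq_3 m_assoc)
    finally show ?case .
  qed simp
  show ?thesis
  proof (induction n arbitrary: m)
    case 0
    show ?case by (rule exI[of _ m]) simp
  next
    case (Suc n)
    obtain k where "J [^] n \<otimes> I [^] (3 * m) = I [^] (k::nat) \<otimes> J [^] n" using Suc.IH by blast
    then have "J [^] Suc n \<otimes> I [^] m = I [^] k \<otimes> J [^] n \<otimes> J"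
      using 1[of m] by (simp add: m_assoc flip: IJ_closed) (metis IJ_closed m_assoc nat_pow_closed)
    then show ?case by (auto simp: m_assoc)
  qed
qed

lemma quat_part_mult:
  assumes "p \<in> quat_part" "q \<in> quat_part"
  shows "p \<otimes> q \<in> quat_part"
proof -
  obtain m n m' n' :: nat
    where p: "p = I [^] m \<otimes> J [^] n" and q: "q = I [^] m' \<otimes> J [^] n'"
    using assms by (auto simp: quat_part_def)
  obtain k :: nat where k: "J [^] n \<otimes> I [^] m' = I [^] k \<otimes> J [^] n"
    using J_pow_past_I_pow by blast
  have "p \<otimes> q = I [^] m \<otimes> (J [^] n \<otimes> I [^] m') \<otimes> J [^] n'" by (simp add: p q m_assoc)
  also have "\<dots> = (I [^] m \<otimes> I [^] k) \<otimes> (J [^] n \<otimes> J [^] n')" by (simp only: k) (simp add: m_assoc)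
  also have "\<dots> = I [^] (m + k) \<otimes> J [^] (n + n')" by (simp only: nat_pow_mult IJ_closed)
  finally show ?thesis by (simp only: quat_partI)
qed

lemma quat_part_bounded: "quat_part = {I [^] (m::nat) \<otimes> J [^] (n::nat) | m n. m < 4 \<and> n < 2}"
proof
  show "quat_part \<subseteq> {I [^] (m::nat) \<otimes> J [^] (n::nat) | m n. m < 4 \<and> n < 2}"
  proof
    fix q assume "q \<in> quat_part"
    then obtain m n :: nat where q: "q = I [^] m \<otimes> J [^] n" by (auto simp: quat_part_def)
    have I4: "I [^] (4::nat) = \<one>" using I_pow_4 by (simp add: numeral_eq_Suc m_assoc)
    have J2: "J [^] (2::nat) = I [^] (2::nat)"
      using I_square_eq_J_square by (simp add: nat_pow_2)
    have "J [^] n = J [^] (2 * (n div 2) + n mod 2)" by simp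
    also have "\<dots> = (J [^] (2::nat)) [^] (n div 2) \<otimes> J [^] (n mod 2)"
      by (simp only: nat_pow_mult nat_pow_pow IJ_closed)
    also have "\<dots> = I [^] (2 * (n div 2)) \<otimes> J [^] (n mod 2)"
      by (simp only: J2 nat_pow_pow IJ_closed)
    finally have "q = I [^] m \<otimes> I [^] (2 * (n div 2)) \<otimes> J [^] (n mod 2)"
      using q by (simp add: m_assoc)
    then have "q = I [^] (m + 2 * (n div 2)) \<otimes> J [^] (n mod 2)"
      by (simp only: nat_pow_mult IJ_closed)
    moreover have "I [^] k = I [^] (k mod 4)" for k :: nat
    proof -
      have "I [^] k = I [^] (4 * (k div 4) + k mod 4)" by simp
      also have "\<dots> = (I [^] (4::nat)) [^] (k div 4) \<otimes> I [^] (k mod 4)"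
        by (simp only: nat_pow_mult nat_pow_pow IJ_closed)
      finally show ?thesis by (simp add: I4)
    qed
    ultimately have "q = I [^] ((m + 2 * (n div 2)) mod 4) \<otimes> J [^] (n mod 2)" by metis
    moreover have "(m + 2 * (n div 2)) mod 4 < 4" "n mod 2 < 2" by simp_all
    ultimately show "q \<in> {I [^] (m::nat) \<otimes> J [^] (n::nat) | m n. m < 4 \<and> n < 2}" by blast
  qed
qed (auto simp: quat_part_def)

text \<open>Conjugation by \<open>x\<close> is a homomorphism, so it is enough to know that it sends \<open>I\<close> and \<open>J\<close> into
  the quaternion part. The statement avoids inverses, in the form in which it moves \<open>x\<close> to the right.\<close>

lemma normalises_quat_part:
  assumes x: "x \<in> carrier G"
    and I: "x \<otimes> I = p \<otimes> x" "p \<in> quat_part" and J: "x \<otimes> J = r \<otimes> x" "r \<in> quat_part"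
    and "q \<in> quat_part"
  shows "\<exists>q'\<in>quat_part. x \<otimes> q = q' \<otimes> x"
proof -
  have pow: "\<exists>q'\<in>quat_part. x \<otimes> g [^] (n::nat) = q' \<otimes> x"
    if g: "g \<in> carrier G" "x \<otimes> g = t \<otimes> x" "t \<in> quat_part" for g t n
  proof (induction n)
    case 0
    show ?case using x quat_part_one by (intro bexI[of _ \<one>]) simp_all
  next
    case (Suc n)
    then obtain q' where q': "q' \<in> quat_part" "x \<otimes> g [^] n = q' \<otimes> x" by blast
    have "x \<otimes> g [^] Suc n = q' \<otimes> x \<otimes> g" using q' g x by (simp flip: m_assoc)
    also have "\<dots> = (q' \<otimes> t) \<otimes> x" using q' g x by (simp add: m_assoc quat_part_closed)
    finally show ?case using q' g quat_part_mult by blast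
  qed
  obtain m n :: nat where q: "q = I [^] m \<otimes> J [^] n" using \<open>q \<in> quat_part\<close> by (auto simp: quat_part_def)
  obtain q1 where q1: "q1 \<in> quat_part" "x \<otimes> I [^] m = q1 \<otimes> x" using pow[OF IJ_closed(1) I] by blast
  obtain q2 where q2: "q2 \<in> quat_part" "x \<otimes> J [^] n = q2 \<otimes> x" using pow[OF IJ_closed(2) J] by blast
  have "x \<otimes> q = (x \<otimes> I [^] m) \<otimes> J [^] n" using x by (simp add: q m_assoc)
  also have "\<dots> = q1 \<otimes> (x \<otimes> J [^] n)" using x q1 by (simp add: m_assoc quat_part_closed)
  also have "\<dots> = (q1 \<otimes> q2) \<otimes> x" using x q1 q2 by (simp add: m_assoc quat_part_closed)
  finally show ?thesis using quat_part_mult q1 q2 by blast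
qed

text \<open>Representatives of the symmetric group on three letters, which is what remains of the group
  generated by \<open>a\<close> and \<open>b\<close> once \<open>I\<close> and \<open>J\<close> are killed.\<close>
definition transversal where "transversal = {\<one>, a, b, a \<otimes> b, b \<otimes> a, a \<otimes> b \<otimes> a}"

definition normal_forms where "normal_forms = {q \<otimes> t | q t. q \<in> quat_part \<and> t \<in> transversal}"

lemma transversal_closed: "t \<in> transversal \<Longrightarrow> t \<in> carrier G"
  by (auto simp: transversal_def)

text \<open>Multiplication permutes the representatives up to a factor \<open>I = a a\<close> or \<open>J = b b\<close> on the left.\<close>

lemma a_transversal: "t \<in> transversal \<Longrightarrow> a \<otimes> t \<in> normal_forms"
proof -
  assume "t \<in> transversal"
  then have "\<exists>t'\<in>transversal. a \<otimes> t = \<one> \<otimes> t' \<or> a \<otimes> t = I \<otimes> t'"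
    by (auto simp: transversal_def m_assoc)
  then show ?thesis unfolding normal_forms_def using quat_part_one quat_part_I by blast
qed

lemma b_transversal: "t \<in> transversal \<Longrightarrow> b \<otimes> t \<in> normal_forms"
proof -
  assume "t \<in> transversal"
  moreover have "b \<otimes> (a \<otimes> b) = a \<otimes> (b \<otimes> a)" using braid by (simp add: m_assoc)
  moreover have "b \<otimes> (a \<otimes> (b \<otimes> a)) = J \<otimes> (a \<otimes> b)"
    using braid by (simp add: m_assoc)
  ultimately have "\<exists>t'\<in>transversal. b \<otimes> t = \<one> \<otimes> t' \<or> b \<otimes> t = J \<otimes> t'"
    by (auto simp: transversal_def m_assoc)
  then show ?thesis unfolding normal_forms_def using quat_part_one quat_part_J by blast
qed

lemma normal_forms_left_mult:
  assumes x: "x \<in> {a, b}" and n: "n \<in> normal_forms"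
  shows "x \<otimes> n \<in> normal_forms"
proof -
  obtain q t where q: "q \<in> quat_part" and t: "t \<in> transversal" and n: "n = q \<otimes> t" using n by (auto simp: normal_forms_def)
  have xG: "x \<in> carrier G" using x by auto
  have "\<exists>q'\<in>quat_part. x \<otimes> q = q' \<otimes> x"
  proof (cases "x = a")
    case True
    show ?thesis
      unfolding True
    proof (rule normalises_quat_part[OF a _ quat_part_I a_J _ q])
      show "I \<otimes> J \<in> quat_part" by (intro quat_part_mult quat_part_I quat_part_J)
    qed (simp add: m_assoc)
  next
    case False
    then have b: "x = b" using x by simp
    show ?thesis
      unfolding b
    proof (rule normalises_quat_part[OF octahedral_pair.a[OF swap] b_I _ _ quat_part_J q])
      show "I \<otimes> I \<otimes> I \<otimes> J \<in> quat_part" by (intro quat_part_mult quat_part_I quat_part_J)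
    qed (simp add: m_assoc)
  qed
  then obtain q' where q': "q' \<in> quat_part" "x \<otimes> q = q' \<otimes> x" by blast
  have "x \<otimes> t \<in> normal_forms" using x t a_transversal b_transversal by blast
  then obtain p t' where p: "p \<in> quat_part" and t': "t' \<in> transversal" "x \<otimes> t = p \<otimes> t'" by (auto simp: normal_forms_def)
  have "x \<otimes> n = (x \<otimes> q) \<otimes> t" using xG q t by (simp add: n m_assoc quat_part_closed transversal_closed)
  also have "\<dots> = q' \<otimes> (x \<otimes> t)" using xG q' t by (simp add: m_assoc quat_part_closed transversal_closed)
  also have "\<dots> = (q' \<otimes> p) \<otimes> t'" using q' p t' by (simp add: m_assoc quat_part_closed transversal_closed)
  finally show ?thesis unfolding normal_forms_def using quat_part_mult[OF q'(1) p] t' by blast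
qed

lemma finite_normal_forms: "finite normal_forms"
proof -
  have "quat_part \<subseteq> (\<lambda>(m, n). I [^] m \<otimes> J [^] n) ` ({..<4::nat} \<times> {..<2::nat})"
    unfolding quat_part_bounded by auto
  then have "finite quat_part" by (rule finite_subset) simp
  moreover have "finite transversal" by (simp add: transversal_def)
  moreover have "normal_forms = (\<lambda>(q, t). q \<otimes> t) ` (quat_part \<times> transversal)" by (auto simp: normal_forms_def)
  ultimately show ?thesis by simp
qed

lemma normal_forms_closed: "n \<in> normal_forms \<Longrightarrow> n \<in> carrier G"
  by (auto simp: normal_forms_def intro: quat_part_closed transversal_closed)

text \<open>Left multiplication by \<open>x\<close> is an injective map from the finite set of normal forms to itself,
  hence a permutation of it, so no normal forms of the inverses are needed.\<close>

lemma normal_forms_left_mult_inv: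
  assumes x: "x \<in> {a, b}" and n: "n \<in> normal_forms"
  shows "inv x \<otimes> n \<in> normal_forms"
proof -
  have xG: "x \<in> carrier G" using x by auto
  have "inj_on (\<lambda>n. x \<otimes> n) normal_forms" using xG by (auto simp: inj_on_def normal_forms_closed)
  then have "(\<lambda>n. x \<otimes> n) ` normal_forms = normal_forms"
    using normal_forms_left_mult[OF x] by (intro endo_inj_surj[OF finite_normal_forms]) auto
  with n obtain n' where "n' \<in> normal_forms" "n = x \<otimes> n'" by blast
  then show ?thesis using xG by (simp add: normal_forms_closed flip: m_assoc)
qed

lemma generate_eq_normal_forms: "generate G {a, b} = normal_forms"
proof
  have "\<forall>n\<in>normal_forms. g \<otimes> n \<in> normal_forms" if "g \<in> generate G {a, b}" for g
    using that
  proof induction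
    case one
    show ?case by (simp add: normal_forms_closed)
  next
    case (incl g)
    then show ?case using normal_forms_left_mult by blast
  next
    case (inv g)
    then show ?case using normal_forms_left_mult_inv by blast
  next
    case (eng g g')
    have "g \<in> carrier G" "g' \<in> carrier G"
      using eng.hyps by (auto intro: generate_in_carrier[of "{a, b}"])
    then show ?case using eng.IH by (simp add: m_assoc normal_forms_closed)
  qed
  moreover have "\<one> \<in> normal_forms" using quat_part_one by (force simp: normal_forms_def transversal_def)
  moreover have "g \<in> carrier G" if "g \<in> generate G {a, b}" for g
    using that by (intro generate_in_carrier[of "{a, b}"]) auto
  ultimately show "generate G {a, b} \<subseteq> normal_forms" by (metis r_one subsetI)
next
  interpret K: subgroup "generate G {a, b}" G by (rule generate_is_subgroup) simp
  have ab: "a \<in> generate G {a, b}" "b \<in> generate G {a, b}" by (auto intro: generate.incl)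
  have pow: "x [^] (n::nat) \<in> generate G {a, b}" if "x \<in> generate G {a, b}" for x n
    using that by (induction n) auto
  have "quat_part \<subseteq> generate G {a, b}" using ab pow by (auto simp: quat_part_def)
  moreover have "transversal \<subseteq> generate G {a, b}" using ab by (auto simp: transversal_def)
  ultimately show "normal_forms \<subseteq> generate G {a, b}" by (auto simp: normal_forms_def)
qed

lemma quat_part_explicit:
  "quat_part = {\<one>, I, I \<otimes> I, I \<otimes> I \<otimes> I, J, I \<otimes> J, I \<otimes> I \<otimes> J, I \<otimes> I \<otimes> I \<otimes> J}"
proof -
  have "quat_part = (\<lambda>(m, n). I [^] m \<otimes> J [^] n) ` ({..<4::nat} \<times> {..<2::nat})"
    unfolding quat_part_bounded by auto
  \<comment> \<open>The exponents are written with \<open>Suc\<close> so that the powers unfold into products.\<close>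
  also have "{..<4::nat} \<times> {..<2::nat} = {0, 1, Suc 1, Suc (Suc 1)} \<times> {0, 1}" by auto
  finally show ?thesis by (simp only: image_insert image_empty split nat_pow_0) auto
qed

end

section \<open>The octahedral relations in the unit quaternions\<close>

fun quat_norm_sq :: "quat \<Rightarrow> real" where
  "quat_norm_sq (Quat a b c d) = a\<^sup>2 + b\<^sup>2 + c\<^sup>2 + d\<^sup>2"

fun quat_conj :: "quat \<Rightarrow> quat" where
  "quat_conj (Quat a b c d) = Quat a (- b) (- c) (- d)"

text \<open>The ambient group of the quaternion computations. Its group laws come from the multiplicative
  norm, and closure of the 48 elements of \<open>2O\<close> under multiplication then needs no case analysis, since
  they form a generated subgroup.\<close>
definition unit_quaternions :: "quat monoid" where
  "unit_quaternions = \<lparr>carrier = {q. quat_norm_sq q = 1}, mult = quat_mult, one = Quat 1 0 0 0\<rparr>"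

lemma unit_quaternions_mult: "p \<otimes>\<^bsub>unit_quaternions\<^esub> q = quat_mult p q"
  by (simp add: unit_quaternions_def)

lemma quat_norm_sq_mult: "quat_norm_sq (quat_mult p q) = quat_norm_sq p * quat_norm_sq q"
  by (cases p; cases q) (simp add: power2_eq_square algebra_simps)

lemma quat_mult_assoc: "quat_mult (quat_mult p q) r = quat_mult p (quat_mult q r)"
  by (cases p; cases q; cases r) (simp add: algebra_simps)

lemma quat_mult_conj: "quat_mult (quat_conj q) q = Quat (quat_norm_sq q) 0 0 0"
  by (cases q) (simp add: power2_eq_square algebra_simps)

lemma group_unit_quaternions: "group unit_quaternions"
proof (rule groupI)
  fix q assume "q \<in> carrier unit_quaternions"
  moreover have "quat_norm_sq (quat_conj q) = quat_norm_sq q" by (cases q) simp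
  ultimately show "\<exists>p\<in>carrier unit_quaternions. p \<otimes>\<^bsub>unit_quaternions\<^esub> q = \<one>\<^bsub>unit_quaternions\<^esub>"
    by (intro bexI[of _ "quat_conj q"]) (simp_all add: unit_quaternions_def quat_mult_conj)
next
  fix q assume "q \<in> carrier unit_quaternions"
  then show "\<one>\<^bsub>unit_quaternions\<^esub> \<otimes>\<^bsub>unit_quaternions\<^esub> q = q"
    by (cases q) (simp add: unit_quaternions_def)
qed (auto simp: unit_quaternions_def quat_norm_sq_mult quat_mult_assoc)

definition \<rho>1 :: quat where "\<rho>1 = Quat (1 / sqrt 2) (1 / sqrt 2) 0 0"
definition \<rho>2 :: quat where "\<rho>2 = Quat (1 / sqrt 2) 0 (1 / sqrt 2) 0"

lemma rho_products:
  "quat_mult \<rho>1 \<rho>1 = Quat 0 1 0 0" "quat_mult \<rho>2 \<rho>2 = Quat 0 0 1 0"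
  "quat_mult \<rho>1 \<rho>2 = Quat (1 / 2) (1 / 2) (1 / 2) (1 / 2)"
  "quat_mult \<rho>2 \<rho>1 = Quat (1 / 2) (1 / 2) (1 / 2) (- 1 / 2)"
  "quat_mult (quat_mult \<rho>1 \<rho>2) \<rho>1 = Quat 0 (1 / sqrt 2) (1 / sqrt 2) 0"
  "quat_mult (quat_mult \<rho>2 \<rho>1) \<rho>2 = Quat 0 (1 / sqrt 2) (1 / sqrt 2) 0"
  by (simp_all add: \<rho>1_def \<rho>2_def)

lemma octahedral_pair_unit_quaternions: "octahedral_pair unit_quaternions \<rho>1 \<rho>2"
proof -
  interpret group unit_quaternions by (rule group_unit_quaternions)
  show ?thesis
    by unfold_locales
      (simp_all add: unit_quaternions_def rho_products, simp_all add: \<rho>1_def \<rho>2_def power_divide)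
qed

interpretation U: octahedral_pair unit_quaternions \<rho>1 \<rho>2
  by (rule octahedral_pair_unit_quaternions)

lemma unit_quat_part: "U.quat_part = {Quat 1 0 0 0, Quat (-1) 0 0 0, Quat 0 1 0 0, Quat 0 (-1) 0 0,
    Quat 0 0 1 0, Quat 0 0 (-1) 0, Quat 0 0 0 1, Quat 0 0 0 (-1)}"
  unfolding U.quat_part_explicit by (auto simp: unit_quaternions_def rho_products)

lemma unit_transversal: "U.transversal = {
    Quat 1 0 0 0, Quat (1 / sqrt 2) (1 / sqrt 2) 0 0, Quat (1 / sqrt 2) 0 (1 / sqrt 2) 0,
    Quat (1 / 2) (1 / 2) (1 / 2) (1 / 2), Quat (1 / 2) (1 / 2) (1 / 2) (- 1 / 2),
    Quat 0 (1 / sqrt 2) (1 / sqrt 2) 0}"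
  unfolding U.transversal_def by (simp add: unit_quaternions_def rho_products) (simp add: \<rho>1_def \<rho>2_def)

section \<open>Comparison of the normal forms with the binary octahedral group\<close>

lemma signs_collect:
  "{f s | s. s \<in> signs} = {f 1, f (-1)}"
  "{g s t | s t. s \<in> signs \<and> t \<in> signs} = {g 1 1, g 1 (-1), g (-1) 1, g (-1) (-1)}"
  "{h s t u v | s t u v. s \<in> signs \<and> t \<in> signs \<and> u \<in> signs \<and> v \<in> signs} =
    (\<Union>s\<in>{1, -1}. \<Union>t\<in>{1, -1}. {h s t 1 1, h s t 1 (-1), h s t (-1) 1, h s t (-1) (-1)})"
  by (auto simp: signs_def)

lemma unit_normal_forms: "U.normal_forms = carrier binary_octahedral_group"
proof -
  have products: "U.normal_forms = (\<Union>q\<in>U.quat_part. \<Union>t\<in>U.transversal. {quat_mult q t})"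
    by (auto simp: U.normal_forms_def unit_quaternions_mult)
  show ?thesis
  proof
    show "U.normal_forms \<subseteq> carrier binary_octahedral_group"
      unfolding products unit_quat_part unit_transversal
        binary_octahedral_group_def hurwitz_units_def octahedral_extra_units_def signs_collect
      by simp
    show "carrier binary_octahedral_group \<subseteq> U.normal_forms"
      unfolding products unit_quat_part unit_transversal
        binary_octahedral_group_def hurwitz_units_def octahedral_extra_units_def signs_collect
      by simp
  qed
qed

text \<open>If \<open>q t = 1\<close>, then \<open>t\<close> lies in the quaternion group of order 8, and the only such
  representative is 1.\<close>

lemma quaternion_normal_form_one:
  assumes "q \<in> U.quat_part" "t \<in> U.transversal" "quat_mult q t = Quat 1 0 0 0"
  shows "q = Quat 1 0 0 0 \<and> t = Quat 1 0 0 0"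
  using assms unfolding unit_quat_part unit_transversal by auto

text \<open>The homomorphism carries the normal form \<open>q t\<close> of \<open>x\<close> to a quaternion normal form of 1, so \<open>h q\<close>
  and \<open>h t\<close> are trivial. As \<open>I\<^sup>m J\<^sup>n\<close> and the representatives have explicitly known images, this
  forces \<open>q\<close> and \<open>t\<close> themselves to be trivial.\<close>

lemma octahedral_pair_hom_kernel:
  fixes G (structure)
  assumes "octahedral_pair G a b"
    and h: "h \<in> hom G unit_quaternions" "h a = \<rho>1" "h b = \<rho>2"
    and x: "x \<in> generate G {a, b}" "h x = Quat 1 0 0 0"
  shows "x = \<one>"
proof -
  interpret P: octahedral_pair G a b by fact
  interpret h: group_hom G unit_quaternions h by unfold_locales (rule h(1))
  obtain q t where q: "q \<in> P.quat_part" and t: "t \<in> P.transversal" and x_eq: "x = q \<otimes> t"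
    using x(1) unfolding P.generate_eq_normal_forms P.normal_forms_def by blast
  have hq: "h q \<in> U.quat_part"
    using q unfolding P.quat_part_explicit U.quat_part_explicit by (auto simp: h)
  have ht: "h t \<in> U.transversal"
    using t unfolding P.transversal_def U.transversal_def by (auto simp: h)
  have "quat_mult (h q) (h t) = Quat 1 0 0 0"
    using x(2) q t by (simp add: x_eq P.quat_part_closed P.transversal_closed unit_quaternions_mult)
  from quaternion_normal_form_one[OF hq ht this]
  have one: "h q = Quat 1 0 0 0" "h t = Quat 1 0 0 0" by auto
  have "q = \<one>"
    using q one(1) unfolding P.quat_part_explicit by (auto simp: h unit_quaternions_mult rho_products)
  moreover have "t = \<one>"
    using t one(2) unfolding P.transversal_def
    by (auto simp: h unit_quaternions_mult rho_products) (simp_all add: \<rho>1_def \<rho>2_def)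
  ultimately show ?thesis by (simp add: x_eq)
qed

theorem proposition4:
  shows "octahedral_presentation \<cong> binary_octahedral_group"
proof -
  define S where "S = {R1, R2}"
  define F where "F = free_group S"
  define r1 where "r1 = free_gen S R1"
  define r2 where "r2 = free_gen S R2"
  define R where "R =
    {(r1 \<otimes>\<^bsub>F\<^esub> r2 \<otimes>\<^bsub>F\<^esub> r1, r2 \<otimes>\<^bsub>F\<^esub> r1 \<otimes>\<^bsub>F\<^esub> r2),
     (r1 [^]\<^bsub>F\<^esub> (2::nat), r2 \<otimes>\<^bsub>F\<^esub> r1 [^]\<^bsub>F\<^esub> (2::nat) \<otimes>\<^bsub>F\<^esub> r2)}"
  define P where "P = presented_group S R"
  have P_eq: "octahedral_presentation = P"
    unfolding octahedral_presentation_def Let_def P_def R_def r1_def r2_def F_def S_def ..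
  interpret F: group F unfolding F_def by (rule group_free_group)
  interpret P: group P using group_octahedral_presentation by (simp add: P_eq)
  have r: "r1 \<in> carrier F" "r2 \<in> carrier F"
    unfolding r1_def r2_def F_def by (rule free_gen_closed, simp add: S_def)+
  have R: "R \<subseteq> carrier (free_group S) \<times> carrier (free_group S)"
    unfolding R_def using r by (simp flip: F_def)
  define k where "k = presented_class S R"
  interpret k: group_hom F P k
    by unfold_locales (simp add: k_def F_def P_def presented_class_hom[OF R])
  have "k (r1 \<otimes>\<^bsub>F\<^esub> r2 \<otimes>\<^bsub>F\<^esub> r1) = k (r2 \<otimes>\<^bsub>F\<^esub> r1 \<otimes>\<^bsub>F\<^esub> r2)"
    "k (r1 [^]\<^bsub>F\<^esub> (2::nat)) = k (r2 \<otimes>\<^bsub>F\<^esub> r1 [^]\<^bsub>F\<^esub> (2::nat) \<otimes>\<^bsub>F\<^esub> r2)"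
    unfolding k_def by (rule presented_class_relation[OF R], simp add: R_def)+
  then have pair: "octahedral_pair P (k r1) (k r2)"
    using r by unfold_locales (simp_all add: F.nat_pow_2)
  have gen: "carrier P = generate P {k r1, k r2}"
    using presented_group_generated[OF R]
    by (simp add: S_def r1_def r2_def P_def k_def)

  obtain h where h: "h \<in> hom F unit_quaternions" "h r1 = \<rho>1" "h r2 = \<rho>2"
  proof (rule U.free_group_universal)
    show "case_generator \<rho>1 \<rho>2 \<in> S \<rightarrow> carrier unit_quaternions"
      by (auto simp: S_def)
  qed (simp add: F_def r1_def r2_def S_def)
  interpret h: group_hom F unit_quaternions h by unfold_locales (rule h(1))
  have "h u = h v" if "(u, v) \<in> R" for u v
    using that r U.braid U.square unfolding R_def by (auto simp: F.nat_pow_2 h)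
  then obtain g where g: "g \<in> hom P unit_quaternions" "\<And>u. u \<in> carrier F \<Longrightarrow> g (k u) = h u"
    using presented_group_universal[OF R group_unit_quaternions h(1)[unfolded F_def]]
    unfolding P_def k_def F_def by metis
  interpret g: group_hom P unit_quaternions g by unfold_locales (rule g(1))

  have "g ` carrier P = generate unit_quaternions (g ` {k r1, k r2})"
    unfolding gen using r by (intro g.generate_img[symmetric]) auto
  also have "g ` {k r1, k r2} = {\<rho>1, \<rho>2}" using r by (simp add: g h)
  also have "generate unit_quaternions {\<rho>1, \<rho>2} = carrier binary_octahedral_group"
    by (simp only: U.generate_eq_normal_forms unit_normal_forms)
  finally have image: "g ` carrier P = carrier binary_octahedral_group" .
  \<comment> \<open>The classes of the two generators generate the presented group, so all its elements
    have normal forms.\<close>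
  have "x = \<one>\<^bsub>P\<^esub>" if "x \<in> carrier P" "g x = \<one>\<^bsub>unit_quaternions\<^esub>" for x
    using octahedral_pair_hom_kernel[OF pair g(1)] that r
    by (simp add: g h gen unit_quaternions_def)
  then have "inj_on g (carrier P)" by (simp add: g.inj_on_one_iff)
  moreover have "g \<in> hom P binary_octahedral_group"
    using g(1) image by (auto simp: hom_def binary_octahedral_group_def unit_quaternions_def)
  ultimately show ?thesis
    unfolding P_eq using image by (intro is_isoI) (simp add: iso_def bij_betw_def)
qed

end
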